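(* The order of $K$-promotion on $\mathrm{Inc}_k(N-r,1^r)$ is equal to $N-k-1$; that is, $N-k-1$ is the smallest positive integer $\ell$ such that $\partial^\ell(T)=T$ for all $T\in\mathrm{Inc}_k(N-r,1^r)$.
   Context: For a partition $\lambda$ of $N$, an increasing $\lambda$-tableau is a filling of the Young diagram of $\lambda$ with positive integers, strictly increasing along rows and down columns, such that if $N-k$ is the largest entry then every integer $1,\dots,N-k$ appears. $\mathrm{Inc}_k(\lambda)$ is the set of such tableaux with maximum entry $N-k$. The hook shape $(N-r,1^r)$ has first row of length $N-r$ and first column of length $r+1$. $K$-promotion $\partial$ on $\mathrm{Inc}_k(N-r,1^r)$: replace the entry $1$ (in box $(1,1)$) by a dot, then repeatedly move dots: a dot with right neighbour $a$ and lower neighbour $b$ becomes: if $a<b$, $a$ moves into the dot's box and the dot moves right; if $b<a$, $b$ moves into the dot's box and the dot moves down; if $a=b$, $a$ moves into the dot's box and dots occupy both the box to the right and the box below (a dot with only one neighbour exchanges with it). Continue until every dot lies in the last box of the row or the last box of the column; then replace each dot by $N-k$ and decrease every other entry by $1$.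
   Formalization: Assumes Inc_k(N-r,1^r) is nonempty (k ≤ r and k+r < N) and, unless N-k-1 = 1, that 0 < r < N-1 and N ≠ 2k+1; in the excluded nonempty cases there is a single tableau, so the order is 1 and the claim fails (e.g. N=3, r=k=0). *)

theory Defs
  imports Main "HOL-Library.While_Combinator"
begin

type_synonym box = "nat \<times> nat"

text \<open>A partition is the list of its parts. Boxes are matrix coordinates (row, column), both
  counted from 1.\<close>

definition young_diagram :: "nat list \<Rightarrow> box set" where
  "young_diagram lam = {(i, j). 1 \<le> i \<and> i \<le> length lam \<and> 1 \<le> j \<and> j \<le> lam ! (i - 1)}"

text \<open>Fillings are total functions; they are normalised to \<open>0\<close> outside the diagram, so that
  equality of functions is equality of tableaux.\<close>

definition increasing_tableau :: "nat list \<Rightarrow> (box \<Rightarrow> nat) \<Rightarrow> bool" where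
  "increasing_tableau lam T \<longleftrightarrow>
     (\<forall>x. x \<notin> young_diagram lam \<longrightarrow> T x = 0) \<and>
     (\<forall>x\<in>young_diagram lam. 0 < T x) \<and>
     (\<forall>i j j'. (i, j) \<in> young_diagram lam \<and> (i, j') \<in> young_diagram lam \<and> j < j'
        \<longrightarrow> T (i, j) < T (i, j')) \<and>
     (\<forall>i i' j. (i, j) \<in> young_diagram lam \<and> (i', j) \<in> young_diagram lam \<and> i < i'
        \<longrightarrow> T (i, j) < T (i', j)) \<and>
     {1..Max (T ` young_diagram lam)} \<subseteq> T ` young_diagram lam"

text \<open>The condition on the maximum says that it is \<open>N - k\<close>, where \<open>N\<close> is the size of the
  partition, without truncated subtraction.\<close>

definition Inc :: "nat \<Rightarrow> nat list \<Rightarrow> (box \<Rightarrow> nat) set" where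
  "Inc k lam = {T. increasing_tableau lam T \<and> Max (T ` young_diagram lam) + k = sum_list lam}"

definition hook :: "nat \<Rightarrow> nat \<Rightarrow> nat list" where
  "hook N r = (N - r) # replicate r 1"

text \<open>During promotion a filling may contain dots, written \<open>None\<close>.\<close>

type_synonym dotted = "box \<Rightarrow> nat option"

fun right_of :: "box \<Rightarrow> box" where "right_of (i, j) = (i, j + 1)"
fun below :: "box \<Rightarrow> box" where "below (i, j) = (i + 1, j)"

text \<open>The boxes to which a dot in box \<open>x\<close> moves; empty iff \<open>x\<close> has neither a right nor a lower
  neighbour, which in a hook means that \<open>x\<close> ends the row or the column.\<close>

definition dot_targets :: "box set \<Rightarrow> dotted \<Rightarrow> box \<Rightarrow> box set" where
  "dot_targets D c x =
     (if right_of x \<in> D \<and> below x \<in> D then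
        (if the (c (right_of x)) < the (c (below x)) then {right_of x}
         else if the (c (below x)) < the (c (right_of x)) then {below x}
         else {right_of x, below x})
      else if right_of x \<in> D then {right_of x}
      else if below x \<in> D then {below x}
      else {})"

text \<open>All dots move simultaneously. This is adequate for hooks only, where two different dots
  never share a neighbour.\<close>

definition move_dots :: "box set \<Rightarrow> dotted \<Rightarrow> dotted" where
  "move_dots D c = (\<lambda>x.
     if x \<in> D \<and> c x = None then
       (if right_of x \<in> dot_targets D c x then c (right_of x)
        else if below x \<in> dot_targets D c x then c (below x)
        else None)
     else if \<exists>d\<in>D. c d = None \<and> x \<in> dot_targets D c d then None
     else c x)"

definition dots_finished :: "box set \<Rightarrow> dotted \<Rightarrow> bool" where
  "dots_finished D c \<longleftrightarrow> (\<forall>x\<in>D. c x = None \<longrightarrow> right_of x \<notin> D \<and> below x \<notin> D)"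

definition K_promotion :: "nat \<Rightarrow> nat \<Rightarrow> nat \<Rightarrow> (box \<Rightarrow> nat) \<Rightarrow> (box \<Rightarrow> nat)" where
  "K_promotion N r k T =
     (let D = young_diagram (hook N r);
          c = while (\<lambda>c. \<not> dots_finished D c) (move_dots D)
                (\<lambda>x. if x = (1, 1) then None else Some (T x))
      in (\<lambda>x. case c x of None \<Rightarrow> N - k | Some v \<Rightarrow> v - 1))"

end

theory Submission
  imports Defs
begin

text \<open>Put \<open>M = N - k\<close>. A hook tableau is determined by the sets \<open>A\<close> and \<open>B\<close> of entries in its arm
  and its leg (the corner, which contains \<open>1\<close>, excluded), which together cover \<open>{2..M}\<close>. The dot
  leaves the corner towards \<open>2\<close>; so it enters the arm iff \<open>2 \<in> A\<close>, the leg iff \<open>2 \<in> B\<close>, and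
  promotion replaces \<open>2\<close> by \<open>M\<close> and lowers all other entries: \<open>A\<close> and \<open>B\<close> are both moved by the
  cyclic rotation of \<open>{2..M}\<close>, which has order \<open>M - 1\<close>. Conversely, in the tableau where \<open>A\<close> is an
  initial and \<open>B\<close> a final segment of \<open>{2..M}\<close>, one of the two is proper and nonempty unless the
  parameters are degenerate, and no smaller rotation fixes it.\<close>

section \<open>Hook tableaux described by arm and leg\<close>

definition hook_boxes :: "nat \<Rightarrow> nat \<Rightarrow> box set" where
  "hook_boxes m n = {(i, j). i = 1 \<and> 1 \<le> j \<and> j \<le> m \<or> j = 1 \<and> 1 \<le> i \<and> i \<le> n}"

text \<open>With \<open>r \<ge> N\<close> the first part would be \<open>0\<close> and the corner
  missing from the diagram, whereas \<open>hook_boxes\<close> would keep it.\<close>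

lemma young_diagram_hook:
  assumes "r < N"
  shows "young_diagram (hook N r) = hook_boxes (N - r) (r + 1)"
proof -
  have "(i, j) \<in> young_diagram (hook N r) \<longleftrightarrow> (i, j) \<in> hook_boxes (N - r) (r + 1)" for i j
    using assms
    by (cases "i - 1") (auto simp: young_diagram_def hook_def hook_boxes_def nth_Cons')
  then show ?thesis by auto
qed

definition arm :: "nat \<Rightarrow> (box \<Rightarrow> nat) \<Rightarrow> nat set" where
  "arm m T = (\<lambda>j. T (1, j)) ` {2..m}"

definition leg :: "nat \<Rightarrow> (box \<Rightarrow> nat) \<Rightarrow> nat set" where
  "leg n T = (\<lambda>i. T (i, 1)) ` {2..n}"

text \<open>The corner's being smallest is encoded by the value \<open>1\<close> there and a union
  that starts at \<open>2\<close>; the same union says that no value is skipped.\<close>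

definition hook_tableau :: "nat \<Rightarrow> nat \<Rightarrow> nat \<Rightarrow> (box \<Rightarrow> nat) \<Rightarrow> bool" where
  "hook_tableau m n M T \<longleftrightarrow>
     (\<forall>x. x \<notin> hook_boxes m n \<longrightarrow> T x = 0) \<and> T (1, 1) = 1 \<and>
     strict_mono_on {2..m} (\<lambda>j. T (1, j)) \<and> strict_mono_on {2..n} (\<lambda>i. T (i, 1)) \<and>
     arm m T \<union> leg n T = {2..M}"

lemma hook_boxes_image:
  assumes "1 \<le> m"
  shows "T ` hook_boxes m n = {T (1, 1)} \<union> arm m T \<union> leg n T"
proof -
  have "hook_boxes m n = {(1, 1)} \<union> (\<lambda>j. (1, j)) ` {2..m} \<union> (\<lambda>i. (i, 1)) ` {2..n}"
    using assms by (auto simp: hook_boxes_def image_iff)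
  then show ?thesis by (simp add: arm_def leg_def image_Un image_image)
qed

text \<open>The entries fill \<open>{1..N - k}\<close> and the corner lies strictly below all
  others, so it holds \<open>1\<close>, and arm and leg share out the rest.\<close>

lemma Inc_hook_imp_hook_tableau:
  assumes rN: "r < N" and T: "T \<in> Inc k (hook N r)"
  shows "hook_tableau (N - r) (r + 1) (N - k) T"
proof -
  let ?D = "hook_boxes (N - r) (r + 1)"
  have sum: "sum_list (hook N r) = N"
    using rN by (simp add: hook_def sum_list_replicate)
  have zero: "\<forall>x. x \<notin> ?D \<longrightarrow> T x = 0"
    and pos: "\<And>x. x \<in> ?D \<Longrightarrow> 0 < T x"
    and row: "\<And>i j j'. (i, j) \<in> ?D \<Longrightarrow> (i, j') \<in> ?D \<Longrightarrow> j < j' \<Longrightarrow> T (i, j) < T (i, j')"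
    and col: "\<And>i i' j. (i, j) \<in> ?D \<Longrightarrow> (i', j) \<in> ?D \<Longrightarrow> i < i' \<Longrightarrow> T (i, j) < T (i', j)"
    and sub: "{1..Max (T ` ?D)} \<subseteq> T ` ?D"
    and Max: "Max (T ` ?D) + k = N"
    using T sum unfolding Inc_def increasing_tableau_def young_diagram_hook[OF rN] by auto
  have "finite (T ` ?D)"
    using rN by (simp add: hook_boxes_image arm_def leg_def)
  then have "T ` ?D \<subseteq> {1..Max (T ` ?D)}"
    using pos by (force simp: Suc_le_eq)
  with sub Max have im: "T ` ?D = {1..N - k}" by (metis add_diff_cancel_right' subset_antisym)
  have corner: "(1, 1) \<in> ?D" using rN by (auto simp: hook_boxes_def)
  have armD: "(1, j) \<in> ?D" if "j \<in> {2..N - r}" for j using that by (auto simp: hook_boxes_def)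
  have legD: "(i, 1) \<in> ?D" if "i \<in> {2..r + 1}" for i using that by (auto simp: hook_boxes_def)
  have gt: "T (1, 1) < v" if "v \<in> arm (N - r) T \<union> leg (r + 1) T" for v
    using that row[OF corner armD] col[OF corner legD] by (auto simp: arm_def leg_def)
  have im': "insert (T (1, 1)) (arm (N - r) T \<union> leg (r + 1) T) = {1..N - k}"
    using hook_boxes_image[of "N - r" T "r + 1"] im rN by simp
  have "T (1, 1) \<in> {1..N - k}" using im corner by blast
  then have "1 \<in> {1..N - k}" by simp
  then have one: "T (1, 1) = 1"
    using im' gt pos[OF corner]
    by (metis insertE less_one less_numeral_extra(3))
  have "arm (N - r) T \<union> leg (r + 1) T = {2..N - k}"
  proof -
    have "1 \<notin> arm (N - r) T \<union> leg (r + 1) T" using gt one by (metis less_irrefl)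
    then have "arm (N - r) T \<union> leg (r + 1) T = {1..N - k} - {1}"
      using im' one by (metis Diff_insert_absorb)
    also have "\<dots> = {2..N - k}" by auto
    finally show ?thesis .
  qed
  then show ?thesis
    using zero one row[OF armD armD] col[OF legD legD]
    by (auto simp: hook_tableau_def strict_mono_on_def)
qed

text \<open>This direction makes the explicit witness for the lower bound a member of
  \<open>Inc\<close>.\<close>

lemma hook_tableau_imp_Inc_hook:
  assumes rN: "r < N" and kN: "k < N" and T: "hook_tableau (N - r) (r + 1) (N - k) T"
  shows "T \<in> Inc k (hook N r)"
proof -
  let ?D = "hook_boxes (N - r) (r + 1)"
  have sum: "sum_list (hook N r) = N"
    using rN by (simp add: hook_def sum_list_replicate)
  have zero: "\<forall>x. x \<notin> ?D \<longrightarrow> T x = 0" and one: "T (1, 1) = 1"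
    and row: "strict_mono_on {2..N - r} (\<lambda>j. T (1, j))"
    and col: "strict_mono_on {2..r + 1} (\<lambda>i. T (i, 1))"
    and un: "arm (N - r) T \<union> leg (r + 1) T = {2..N - k}"
    using T by (auto simp: hook_tableau_def)
  have im: "T ` ?D = {1..N - k}"
    using hook_boxes_image[of "N - r" T "r + 1"] rN kN one un by auto
  then have Max: "Max (T ` ?D) = N - k" using kN by (auto intro: Max_eqI)
  have armgt: "1 < T (1, j)" if "2 \<le> j" "j \<le> N - r" for j
  proof -
    have "T (1, j) \<in> {2..N - k}" using that un[symmetric] by (auto simp: arm_def)
    then show ?thesis by auto
  qed
  have leggt: "1 < T (i, 1)" if "2 \<le> i" "i \<le> r + 1" for i
  proof -
    have "T (i, 1) \<in> {2..N - k}" using that un[symmetric] by (auto simp: leg_def)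
    then show ?thesis by auto
  qed
  have rows: "T (i, j) < T (i, j')" if "(i, j) \<in> ?D" "(i, j') \<in> ?D" "j < j'" for i j j'
  proof -
    have "i = 1" "1 \<le> j" "j' \<le> N - r" using that by (auto simp: hook_boxes_def)
    then show ?thesis
      using that(3) one armgt[of j'] strict_mono_onD[OF row, of j j']
      by (cases "j = 1") auto
  qed
  have cols: "T (i, j) < T (i', j)" if "(i, j) \<in> ?D" "(i', j) \<in> ?D" "i < i'" for i i' j
  proof -
    have "j = 1" "1 \<le> i" "i' \<le> r + 1" using that by (auto simp: hook_boxes_def)
    then show ?thesis
      using that(3) one leggt[of i'] strict_mono_onD[OF col, of i i']
      by (cases "i = 1") auto
  qed
  have pos: "0 < T x" if "x \<in> ?D" for x
  proof -
    have "T x \<in> {1..N - k}" using im that by blast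
    then show ?thesis by auto
  qed
  show ?thesis
    unfolding Inc_def increasing_tableau_def young_diagram_hook[OF rN] mem_Collect_eq sum
    using zero pos rows cols im Max kN by auto
qed

text \<open>The value list of a strictly increasing function on an interval is the sorted list of
  its image.\<close>

lemma strict_mono_on_image_eq:
  fixes f g :: "nat \<Rightarrow> nat"
  assumes "strict_mono_on {a..b} f" "strict_mono_on {a..b} g" "f ` {a..b} = g ` {a..b}"
    and "x \<in> {a..b}"
  shows "f x = g x"
proof -
  have "map h [a..<Suc b] = sorted_list_of_set (h ` {a..b})" if "strict_mono_on {a..b} h" for h :: "nat \<Rightarrow> nat"
  proof (rule sorted_distinct_set_unique)
    have "sorted_wrt (\<lambda>x y. h x < h y) [a..<Suc b]"
      by (rule sorted_wrt_mono_rel[OF _ sorted_wrt_upt])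
        (use strict_mono_onD[OF that] in \<open>auto simp: less_Suc_eq_le\<close>)
    then have "sorted_wrt (<) (map h [a..<Suc b])" by (simp only: sorted_wrt_map)
    then show "sorted (map h [a..<Suc b])" "distinct (map h [a..<Suc b])"
      using strict_sorted_iff by blast+
  qed (auto simp: atLeastLessThanSuc_atLeastAtMost)
  from this[OF assms(1)] this[OF assms(2)] assms(3)
  have "map f [a..<Suc b] = map g [a..<Suc b]" by simp
  then have "\<forall>y\<in>set [a..<Suc b]. f y = g y" by (simp only: map_eq_conv)
  then show ?thesis using assms(4) by (simp add: atLeastLessThanSuc_atLeastAtMost del: upt_Suc)
qed

text \<open>This reduces promotion on tableaux to its effect on two sets of numbers.\<close>

lemma hook_tableau_eqI:
  assumes S: "hook_tableau m n M S" and T: "hook_tableau m n M T"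
    and "arm m S = arm m T" "leg n S = leg n T"
  shows "S = T"
proof
  fix x :: box
  obtain i j where x: "x = (i, j)" by (cases x)
  consider "x \<notin> hook_boxes m n" | "x = (1, 1)" | "i = 1" "j \<in> {2..m}" | "j = 1" "i \<in> {2..n}"
    unfolding x hook_boxes_def by force
  then show "S x = T x"
  proof cases
    case 3
    then show ?thesis
      using S T assms(3) strict_mono_on_image_eq[of 2 m "\<lambda>j. S (1, j)" "\<lambda>j. T (1, j)" j]
      by (simp add: x hook_tableau_def arm_def)
  next
    case 4
    then show ?thesis
      using S T assms(4) strict_mono_on_image_eq[of 2 n "\<lambda>i. S (i, 1)" "\<lambda>i. T (i, 1)" i]
      by (simp add: x hook_tableau_def leg_def)
  qed (use S T in \<open>simp_all add: hook_tableau_def x\<close>)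
qed

section \<open>The course of the dots through a hook\<close>

text \<open>An explicit trace \<open>c\<close> replaces a termination measure: \<open>while\<close>
  is unfolded by downward induction from the final state.\<close>

lemma while_sequence:
  assumes "\<And>s. s < K \<Longrightarrow> b (c s)" "\<And>s. s < K \<Longrightarrow> f (c s) = c (Suc s)" "\<not> b (c K)"
  shows "while b f (c 0) = c K"
proof -
  have "s \<le> K \<Longrightarrow> while b f (c s) = c K" for s
  proof (induction s rule: inc_induct)
    case base
    then show ?case using assms(3) by (simp add: while_unfold)
  next
    case (step s)
    then show ?case using assms(1,2)[of s] while_unfold[of b f "c s"] by simp
  qed
  from this[of 0] show ?thesis by simp
qed

text \<open>An arm (or leg) with entries \<open>f\<close> in the positions \<open>2..m\<close> after \<open>s\<close> moves; \<open>p\<close> tells whether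
  a dot enters it from the corner at all. The dot stops at position \<open>m\<close>.\<close>

definition slide :: "nat \<Rightarrow> bool \<Rightarrow> nat \<Rightarrow> (nat \<Rightarrow> nat) \<Rightarrow> nat \<Rightarrow> nat option" where
  "slide m p s f j =
     (if p \<and> 2 \<le> j \<and> j < min (Suc s) m then Some (f (Suc j))
      else if p \<and> 2 \<le> j \<and> j = min (Suc s) m then None
      else Some (f j))"

text \<open>A closed form of the filling after \<open>s\<close> moves. At \<open>s = 0\<close> the
  only dot is in the corner, since \<open>min (Suc s) m\<close> is below \<open>2\<close>. If
  \<open>p\<close> and \<open>q\<close> both hold, the two candidates for the corner agree in the
  intended use.\<close>

definition hook_state ::
  "nat \<Rightarrow> nat \<Rightarrow> bool \<Rightarrow> bool \<Rightarrow> (box \<Rightarrow> nat) \<Rightarrow> nat \<Rightarrow> dotted" where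
  "hook_state m n p q T s = (\<lambda>(i, j).
     if i = 1 \<and> j = 1 then (if s = 0 then None else Some (if p then T (1, 2) else T (2, 1)))
     else if i = 1 then slide m p s (\<lambda>j. T (1, j)) j
     else if j = 1 then slide n q s (\<lambda>i. T (i, 1)) i
     else Some (T (i, j)))"

lemma hook_state_eq_None_iff:
  assumes "p \<longrightarrow> 2 \<le> m" "q \<longrightarrow> 2 \<le> n" "0 < s"
  shows "hook_state m n p q T s x = None \<longleftrightarrow>
    p \<and> x = (1, min (Suc s) m) \<or> q \<and> x = (min (Suc s) n, 1)"
  using assms by (cases x) (auto simp: hook_state_def slide_def)

text \<open>Past the corner an arm box has no lower neighbour in the hook, so nothing is compared
  and \<open>c\<close> is arbitrary.\<close>

lemma dot_targets_arm:
  assumes "2 \<le> j" "j \<le> m"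
  shows "dot_targets (hook_boxes m n) c (1, j) = (if j < m then {(1, Suc j)} else {})"
  using assms by (auto simp: dot_targets_def hook_boxes_def)

lemma dot_targets_leg:
  assumes "2 \<le> i" "i \<le> n"
  shows "dot_targets (hook_boxes m n) c (i, 1) = (if i < n then {(Suc i, 1)} else {})"
  using assms by (auto simp: dot_targets_def hook_boxes_def)

lemma move_dots_arm:
  assumes "2 \<le> j" "j \<le> m" "c (1, j) = None"
  shows "move_dots (hook_boxes m n) c (1, j) = (if j < m then c (1, Suc j) else None)"
proof -
  have "(1, j) \<in> hook_boxes m n" using assms by (simp add: hook_boxes_def)
  with assms(3) show ?thesis unfolding move_dots_def dot_targets_arm[OF assms(1,2)] by simp
qed

lemma move_dots_leg:
  assumes "2 \<le> i" "i \<le> n" "c (i, 1) = None"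
  shows "move_dots (hook_boxes m n) c (i, 1) = (if i < n then c (Suc i, 1) else None)"
proof -
  have "(i, 1) \<in> hook_boxes m n" using assms by (simp add: hook_boxes_def)
  with assms(3) show ?thesis unfolding move_dots_def dot_targets_leg[OF assms(1,2)] by simp
qed

lemma move_dots_entry:
  "c x \<noteq> None \<Longrightarrow>
    move_dots D c x = (if \<exists>d\<in>D. c d = None \<and> x \<in> dot_targets D c d then None else c x)"
  by (simp add: move_dots_def del: not_None_eq)

text \<open>After the first move arm and leg evolve independently: each has at most one dot, which
  steps outward or rests in the last box.\<close>

lemma move_dots_hook_state_Suc:
  assumes "p \<longrightarrow> 2 \<le> m" "q \<longrightarrow> 2 \<le> n" "0 < s"
  shows "move_dots (hook_boxes m n) (hook_state m n p q T s) = hook_state m n p q T (Suc s)"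
proof
  fix x :: box
  let ?D = "hook_boxes m n" and ?c = "hook_state m n p q T s"
  let ?a = "(1, min (Suc s) m) :: box" and ?b = "(min (Suc s) n, 1) :: box"
  obtain i j where x: "x = (i, j)" by (cases x)
  have a: "dot_targets ?D ?c ?a = (if Suc s < m then {(1, Suc (Suc s))} else {})" if p
    by (subst dot_targets_arm) (use assms that in auto)
  have b: "dot_targets ?D ?c ?b = (if Suc s < n then {(Suc (Suc s), 1)} else {})" if q
    by (subst dot_targets_leg) (use assms that in auto)
  have tgt: "(\<exists>d\<in>?D. ?c d = None \<and> x \<in> dot_targets ?D ?c d) \<longleftrightarrow>
      p \<and> Suc s < m \<and> x = (1, Suc (Suc s)) \<or> q \<and> Suc s < n \<and> x = (Suc (Suc s), 1)"
  proof -
    have "(\<exists>d\<in>?D. ?c d = None \<and> x \<in> dot_targets ?D ?c d) \<longleftrightarrow>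
        p \<and> x \<in> dot_targets ?D ?c ?a \<or> q \<and> x \<in> dot_targets ?D ?c ?b"
    proof -
      have "p \<Longrightarrow> ?a \<in> ?D" "q \<Longrightarrow> ?b \<in> ?D" using assms by (auto simp: hook_boxes_def)
      then show ?thesis unfolding hook_state_eq_None_iff[OF assms] by blast
    qed
    also have "\<dots> \<longleftrightarrow> p \<and> Suc s < m \<and> x = (1, Suc (Suc s)) \<or> q \<and> Suc s < n \<and> x = (Suc (Suc s), 1)"
      using a b by (metis empty_iff singleton_iff)
    finally show ?thesis .
  qed
  consider "p" "x = ?a" | "q" "x = ?b" | "?c x \<noteq> None"
    using hook_state_eq_None_iff[OF assms] by blast
  then show "move_dots ?D ?c x = hook_state m n p q T (Suc s) x"
  proof cases
    case 1
    have "?c ?a = None" using 1(1) hook_state_eq_None_iff[OF assms] by blast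
    then have "move_dots ?D ?c x = (if min (Suc s) m < m then ?c (1, Suc (min (Suc s) m)) else None)"
      unfolding 1(2) by (rule move_dots_arm[rotated 2]) (use 1(1) assms in auto)
    also have "\<dots> = hook_state m n p q T (Suc s) x"
      using 1 assms by (cases "Suc s < m") (auto simp: hook_state_def slide_def)
    finally show ?thesis .
  next
    case 2
    have "?c ?b = None" using 2(1) hook_state_eq_None_iff[OF assms] by blast
    then have "move_dots ?D ?c x = (if min (Suc s) n < n then ?c (Suc (min (Suc s) n), 1) else None)"
      unfolding 2(2) by (rule move_dots_leg[rotated 2]) (use 2(1) assms in auto)
    also have "\<dots> = hook_state m n p q T (Suc s) x"
      using 2 assms by (cases "Suc s < n") (auto simp: hook_state_def slide_def)
    finally show ?thesis .
  next
    case 3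
    then have "move_dots ?D ?c x =
      (if p \<and> Suc s < m \<and> x = (1, Suc (Suc s)) \<or> q \<and> Suc s < n \<and> x = (Suc (Suc s), 1)
       then None else ?c x)"
      unfolding tgt[symmetric] by (rule move_dots_entry)
    with 3 show ?thesis
      using assms by (auto simp: x hook_state_def slide_def min_def split: if_splits)
  qed
qed

text \<open>Only in this move do two neighbours compete. The conditions on \<open>p\<close> and
  \<open>q\<close> are the dot rule; both hold in a tie, when the dot splits.\<close>

lemma move_dots_hook_state_0:
  assumes "p \<longleftrightarrow> 2 \<le> m \<and> (2 \<le> n \<longrightarrow> T (1, 2) \<le> T (2, 1))"
    and "q \<longleftrightarrow> 2 \<le> n \<and> (2 \<le> m \<longrightarrow> T (2, 1) \<le> T (1, 2))"
    and "p \<or> q"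
  shows "move_dots (hook_boxes m n) (hook_state m n p q T 0) = hook_state m n p q T (Suc 0)"
proof
  fix x :: box
  let ?D = "hook_boxes m n" and ?c = "hook_state m n p q T 0"
  obtain i j where x: "x = (i, j)" by (cases x)
  have None: "?c y = None \<longleftrightarrow> y = (1, 1)" for y
    by (cases y) (auto simp: hook_state_def slide_def)
  have D: "(1, 1) \<in> ?D" "(1, 2) \<in> ?D \<longleftrightarrow> 2 \<le> m" "(2, 1) \<in> ?D \<longleftrightarrow> 2 \<le> n"
    using assms by (auto simp: hook_boxes_def)
  have c: "?c (1, 2) = Some (T (1, 2))" "?c (2, 1) = Some (T (2, 1))"
    by (auto simp: hook_state_def slide_def)
  have nb: "right_of (1, 1) = (1, 2)" "below (1, 1) = (2, 1)" by simp_all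
  have tgt: "dot_targets ?D ?c (1, 1) = {y. p \<and> y = (1, 2) \<or> q \<and> y = (2, 1)}"
    unfolding dot_targets_def nb D c using assms by auto
  have "move_dots ?D ?c x =
    (if x = (1, 1) then Some (if p then T (1, 2) else T (2, 1))
     else if p \<and> x = (1, 2) \<or> q \<and> x = (2, 1) then None else ?c x)"
  proof (cases "x = (1, 1)")
    case True
    then show ?thesis
      unfolding move_dots_def None True tgt nb c mem_Collect_eq using D(1) assms(3) by auto
  next
    case False
    then show ?thesis
      unfolding move_dots_def None using D(1) tgt by auto
  qed
  then show "move_dots ?D ?c x = hook_state m n p q T (Suc 0) x"
    using assms by (auto simp: x hook_state_def slide_def)
qed

lemma dots_finished_hook_state:
  assumes "p \<longrightarrow> 2 \<le> m" "q \<longrightarrow> 2 \<le> n" "p \<or> q" "1 \<le> m"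
  shows "dots_finished (hook_boxes m n) (hook_state m n p q T s) \<longleftrightarrow>
    (p \<longrightarrow> m \<le> Suc s) \<and> (q \<longrightarrow> n \<le> Suc s)"
proof (cases "s = 0")
  case True
  \<comment> \<open>The corner still holds a dot and, by \<open>p \<or> q\<close>, has a
    neighbour.\<close>
  have "\<not> dots_finished (hook_boxes m n) (hook_state m n p q T 0)"
    unfolding dots_finished_def
    using assms by (intro notI, elim ballE[of _ _ "(1, 1)"]) (auto simp: hook_state_def hook_boxes_def)
  with True show ?thesis using assms by auto
next
  case False
  let ?D = "hook_boxes m n"
  let ?a = "(1, min (Suc s) m) :: box" and ?b = "(min (Suc s) n, 1) :: box"
  have "p \<Longrightarrow> ?a \<in> ?D" "q \<Longrightarrow> ?b \<in> ?D" using assms by (auto simp: hook_boxes_def)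
  then have "dots_finished ?D (hook_state m n p q T s) \<longleftrightarrow>
    (p \<longrightarrow> right_of ?a \<notin> ?D \<and> below ?a \<notin> ?D) \<and> (q \<longrightarrow> right_of ?b \<notin> ?D \<and> below ?b \<notin> ?D)"
    unfolding dots_finished_def hook_state_eq_None_iff[OF assms(1,2) False[unfolded neq0_conv]]
    by blast
  also have "\<dots> \<longleftrightarrow> (p \<longrightarrow> m \<le> Suc s) \<and> (q \<longrightarrow> n \<le> Suc s)"
    using assms False by (auto simp: hook_boxes_def)
  finally show ?thesis .
qed

text \<open>All values are read off from \<open>hook_state\<close> at the moment when the last dot
  stops. \<open>2 \<le> N - k\<close> ensures that a \<open>2\<close> exists, which then lies next
  to the corner.\<close>

lemma K_promotion_hook:
  assumes rN: "r < N" and M: "2 \<le> N - k" and T: "hook_tableau (N - r) (r + 1) (N - k) T"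
  defines "m \<equiv> N - r" and "n \<equiv> r + 1" and "P \<equiv> K_promotion N r k T"
  shows "x \<notin> hook_boxes m n \<Longrightarrow> P x = 0"
    and "P (1, 1) = 1"
    and "j \<in> {2..m} \<Longrightarrow>
      P (1, j) = (if 2 \<in> arm m T then if j < m then T (1, Suc j) - 1 else N - k else T (1, j) - 1)"
    and "i \<in> {2..n} \<Longrightarrow>
      P (i, 1) = (if 2 \<in> leg n T then if i < n then T (Suc i, 1) - 1 else N - k else T (i, 1) - 1)"
proof -
  let ?D = "hook_boxes m n"
  define p where "p \<longleftrightarrow> 2 \<in> arm m T"
  define q where "q \<longleftrightarrow> 2 \<in> leg n T"
  have zero: "\<And>x. x \<notin> ?D \<Longrightarrow> T x = 0" and one: "T (1, 1) = 1"
    and row: "strict_mono_on {2..m} (\<lambda>j. T (1, j))"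
    and col: "strict_mono_on {2..n} (\<lambda>i. T (i, 1))"
    and un: "arm m T \<union> leg n T = {2..N - k}"
    using T by (auto simp: hook_tableau_def m_def n_def)
  have ge: "2 \<le> v" if "v \<in> arm m T \<union> leg n T" for v using that un by simp
  have pq: "p \<or> q" using un M by (auto simp: p_def q_def)
  \<comment> \<open>A \<open>2\<close> in the arm is its least entry, hence sits in its first
    box.\<close>
  have p2: "p \<longleftrightarrow> 2 \<le> m \<and> T (1, 2) = 2"
  proof
    assume p
    then obtain j where j: "j \<in> {2..m}" "T (1, j) = 2" by (auto simp: p_def arm_def)
    have "2 \<le> T (1, 2)" using j ge[of "T (1, 2)"] by (auto simp: arm_def)
    then have "j = 2" using strict_mono_onD[OF row, of 2 j] j by (cases "j = 2") auto
    then show "2 \<le> m \<and> T (1, 2) = 2" using j by auto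
  qed (auto simp: p_def arm_def image_iff intro!: bexI[of _ 2])
  have q2: "q \<longleftrightarrow> 2 \<le> n \<and> T (2, 1) = 2"
  proof
    assume q
    then obtain j where j: "j \<in> {2..n}" "T (j, 1) = 2" by (auto simp: q_def leg_def)
    have "2 \<le> T (2, 1)" using j ge[of "T (2, 1)"] by (auto simp: leg_def)
    then have "j = 2" using strict_mono_onD[OF col, of 2 j] j by (cases "j = 2") auto
    then show "2 \<le> n \<and> T (2, 1) = 2" using j by auto
  qed (auto simp: q_def leg_def image_iff intro!: bexI[of _ 2])
  have ge1: "2 \<le> m \<Longrightarrow> 2 \<le> T (1, 2)" using ge[of "T (1, 2)"] by (auto simp: arm_def)
  have ge2: "2 \<le> n \<Longrightarrow> 2 \<le> T (2, 1)" using ge[of "T (2, 1)"] by (auto simp: leg_def)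
  have pm: "p \<longrightarrow> 2 \<le> m" and qn: "q \<longrightarrow> 2 \<le> n" using p2 q2 by auto
  \<comment> \<open>At least one neighbour of the corner is \<open>2\<close> and none is smaller, so
    the positions of the \<open>2\<close>s decide the comparison.\<close>
  have p_iff: "p \<longleftrightarrow> 2 \<le> m \<and> (2 \<le> n \<longrightarrow> T (1, 2) \<le> T (2, 1))"
    and q_iff: "q \<longleftrightarrow> 2 \<le> n \<and> (2 \<le> m \<longrightarrow> T (2, 1) \<le> T (1, 2))"
    using p2 q2 pq ge1 ge2 by linarith+
  \<comment> \<open>The longest journey of a dot: \<open>m - 1\<close> moves to the end of the arm,
    \<open>n - 1\<close> to the end of the leg, \<open>0\<close> where none enters.\<close>
  define K where "K = max (if p then m - 1 else 0) (if q then n - 1 else 0)"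
  have m1: "1 \<le> m" using rN by (simp add: m_def)
  have "while (\<lambda>c. \<not> dots_finished ?D c) (move_dots ?D) (hook_state m n p q T 0) =
      hook_state m n p q T K"
  proof (rule while_sequence)
    show "\<not> dots_finished ?D (hook_state m n p q T s)" if "s < K" for s
      unfolding dots_finished_hook_state[OF pm qn pq m1]
      using that by (auto simp: K_def max_def split: if_splits)
    show "\<not> \<not> dots_finished ?D (hook_state m n p q T K)"
      unfolding not_not dots_finished_hook_state[OF pm qn pq m1] by (auto simp: K_def)
    show "move_dots ?D (hook_state m n p q T s) = hook_state m n p q T (Suc s)" for s
      using move_dots_hook_state_0[of p m n T q, OF p_iff q_iff pq]
        move_dots_hook_state_Suc[OF pm qn, of s T]
      by (cases "s = 0") auto
  qed
  moreover have "hook_state m n p q T 0 = (\<lambda>x. if x = (1, 1) then None else Some (T x))"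
    by (auto simp: hook_state_def slide_def fun_eq_iff)
  ultimately have P: "P x = (case hook_state m n p q T K x of None \<Rightarrow> N - k | Some v \<Rightarrow> v - 1)" for x
    unfolding P_def K_promotion_def young_diagram_hook[OF rN] m_def n_def by simp
  have "K > 0" using pq pm qn by (auto simp: K_def)
  \<comment> \<open>The corner has received the \<open>2\<close>, which is lowered to
    \<open>1\<close>.\<close>
  then show "P (1, 1) = 1" using pq p2 q2 by (auto simp: P hook_state_def)
  have Kp: "p \<Longrightarrow> min (Suc K) m = m" and Kq: "q \<Longrightarrow> min (Suc K) n = n" by (auto simp: K_def)
  show "P (1, j) = (if 2 \<in> arm m T then if j < m then T (1, Suc j) - 1 else N - k else T (1, j) - 1)"
    if "j \<in> {2..m}"
    using that Kp unfolding P p_def[symmetric] by (auto simp: hook_state_def slide_def)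
  show "P (i, 1) = (if 2 \<in> leg n T then if i < n then T (Suc i, 1) - 1 else N - k else T (i, 1) - 1)"
    if "i \<in> {2..n}"
    using that Kq unfolding P q_def[symmetric] by (auto simp: hook_state_def slide_def)
  show "P x = 0" if "x \<notin> ?D"
  proof -
    obtain i j where x: "x = (i, j)" by (cases x)
    have "i = 1 \<Longrightarrow> j = 0 \<or> m < j" "j = 1 \<Longrightarrow> i = 0 \<or> n < i" "\<not> (i = 1 \<and> j = 1)"
      using that m1 by (auto simp: x hook_boxes_def)
    then have "hook_state m n p q T K x = Some (T x)"
      by (auto simp: x hook_state_def slide_def)
    \<comment> \<open>Truncated subtraction keeps the default value:
      \<open>0 - 1 = 0\<close>.\<close>
    then show ?thesis using zero[OF that] by (simp add: P)
  qed
qed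

section \<open>Promotion as rotation of arm and leg\<close>

definition rot :: "nat \<Rightarrow> nat \<Rightarrow> nat" where
  "rot M x = (if x = 2 then M else x - 1)"

text \<open>Serves arm and leg alike. If the strip starts with \<open>2\<close>, that entry is
  dropped and \<open>M\<close> appended; the order survives because the lowered entries stay below
  \<open>M\<close>.\<close>

lemma slide_image_rot:
  fixes f g :: "nat \<Rightarrow> nat"
  assumes mono: "strict_mono_on {2..m} f" and sub: "f ` {2..m} \<subseteq> {2..M}"
    and g: "\<And>j. j \<in> {2..m} \<Longrightarrow>
      g j = (if 2 \<in> f ` {2..m} then if j < m then f (Suc j) - 1 else M else f j - 1)"
  shows "strict_mono_on {2..m} g" "g ` {2..m} = rot M ` f ` {2..m}"
proof -
  have le: "2 \<le> f j" "f j \<le> M" if "j \<in> {2..m}" for j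
    using sub imageI[OF that, of f] by auto
  have lt: "f i < f j" if "i \<in> {2..m}" "j \<in> {2..m}" "i < j" for i j
    using strict_mono_onD[OF mono] that by blast
  show "strict_mono_on {2..m} g"
  proof (rule strict_mono_onI)
    fix i j assume ij: "i \<in> {2..m}" "j \<in> {2..m}" "i < j"
    have s: "Suc i \<in> {2..m}" using ij by auto
    show "g i < g j"
    proof (cases "2 \<in> f ` {2..m}")
      case False
      then show ?thesis using g ij le(1)[of i] lt[of i j] by simp
    next
      case True
      show ?thesis
      proof (cases "j < m")
        case j: True
        have s': "Suc j \<in> {2..m}" using ij j by auto
        show ?thesis using g ij True j le(1)[OF s] lt[OF s s'] by simp
      next
        case j: False
        show ?thesis using g ij True j le[OF s] by simp
      qed
    qed
  qed
  show "g ` {2..m} = rot M ` f ` {2..m}"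
  proof (cases "2 \<in> f ` {2..m}")
    case False
    have "g j = rot M (f j)" if "j \<in> {2..m}" for j
      using that False g[OF that] by (auto simp: rot_def)
    then show ?thesis by (simp add: image_image)
  next
    case True
    then obtain j0 where j0: "j0 \<in> {2..m}" "f j0 = 2" by auto
    have "j0 = 2" using lt[of 2 j0] le(1)[of 2] j0 by (cases "j0 = 2") auto
    with j0 have m: "2 \<le> m" and f2: "f 2 = 2" by auto
    have gj: "g j = rot M (f (Suc j))" if "j \<in> {2..<m}" for j
      using that True g[of j] lt[of 2 "Suc j"] f2 by (simp add: rot_def)
    have gm: "g m = rot M (f 2)" using m True g[of m] f2 by (simp add: rot_def)
    \<comment> \<open>The appended entry of \<open>g\<close> sits at \<open>m\<close> and comes from
      position \<open>2\<close> of \<open>f\<close>; the other positions correspond under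
      \<open>Suc\<close>.\<close>
    have "{2..m} = insert m {2..<m}" "{2..m} = insert 2 (Suc ` {2..<m})"
      using m by (auto simp: image_Suc_atLeastLessThan)
    then show ?thesis using gj gm by (metis (no_types, lifting) image_cong image_image image_insert)
  qed
qed

text \<open>As \<open>rot\<close> permutes \<open>{2..N - k}\<close>, the rotated arm and leg still
  cover it, so promotion can be iterated within hook tableaux.\<close>

lemma hook_tableau_K_promotion:
  assumes rN: "r < N" and M: "2 \<le> N - k" and T: "hook_tableau (N - r) (r + 1) (N - k) T"
  shows "arm (N - r) (K_promotion N r k T) = rot (N - k) ` arm (N - r) T"
    and "leg (r + 1) (K_promotion N r k T) = rot (N - k) ` leg (r + 1) T"
    and "hook_tableau (N - r) (r + 1) (N - k) (K_promotion N r k T)"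
proof -
  let ?P = "K_promotion N r k T"
  note promo = K_promotion_hook[OF rN M T]
  have row: "strict_mono_on {2..N - r} (\<lambda>j. T (1, j))"
    and col: "strict_mono_on {2..r + 1} (\<lambda>i. T (i, 1))"
    and un: "arm (N - r) T \<union> leg (r + 1) T = {2..N - k}"
    using T by (auto simp: hook_tableau_def)
  have subs: "arm (N - r) T \<subseteq> {2..N - k}" "leg (r + 1) T \<subseteq> {2..N - k}" using un by blast+
  have A: "strict_mono_on {2..N - r} (\<lambda>j. ?P (1, j))"
      "(\<lambda>j. ?P (1, j)) ` {2..N - r} = rot (N - k) ` (\<lambda>j. T (1, j)) ` {2..N - r}"
    using slide_image_rot[OF row subs(1)[unfolded arm_def], of "\<lambda>j. ?P (1, j)"] promo(3)
    unfolding arm_def by blast+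
  have L: "strict_mono_on {2..r + 1} (\<lambda>i. ?P (i, 1))"
      "(\<lambda>i. ?P (i, 1)) ` {2..r + 1} = rot (N - k) ` (\<lambda>i. T (i, 1)) ` {2..r + 1}"
    using slide_image_rot[OF col subs(2)[unfolded leg_def], of "\<lambda>i. ?P (i, 1)"] promo(4)
    unfolding leg_def by blast+
  show arm: "arm (N - r) ?P = rot (N - k) ` arm (N - r) T" using A(2) by (simp only: arm_def)
  show leg: "leg (r + 1) ?P = rot (N - k) ` leg (r + 1) T" using L(2) by (simp only: leg_def)
  have "rot (N - k) ` {2..N - k} = {2..N - k}"
  proof
    show "rot (N - k) ` {2..N - k} \<subseteq> {2..N - k}" using M by (auto simp: rot_def)
    show "{2..N - k} \<subseteq> rot (N - k) ` {2..N - k}"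
    proof
      fix y assume "y \<in> {2..N - k}"
      then show "y \<in> rot (N - k) ` {2..N - k}"
        using M by (intro image_eqI[of _ _ "if y = N - k then 2 else Suc y"]) (auto simp: rot_def)
    qed
  qed
  then have "arm (N - r) ?P \<union> leg (r + 1) ?P = {2..N - k}"
    unfolding arm leg image_Un[symmetric] un .
  then show "hook_tableau (N - r) (r + 1) (N - k) ?P"
    unfolding hook_tableau_def using promo(1,2) A(1) L(1) by blast
qed

lemma hook_tableau_funpow_K_promotion:
  assumes rN: "r < N" and M: "2 \<le> N - k" and T: "hook_tableau (N - r) (r + 1) (N - k) T"
  shows "hook_tableau (N - r) (r + 1) (N - k) ((K_promotion N r k ^^ l) T)
    \<and> arm (N - r) ((K_promotion N r k ^^ l) T) = (rot (N - k) ^^ l) ` arm (N - r) T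
    \<and> leg (r + 1) ((K_promotion N r k ^^ l) T) = (rot (N - k) ^^ l) ` leg (r + 1) T"
proof (induction l)
  case 0
  then show ?case using T by simp
next
  case (Suc l)
  then show ?case using hook_tableau_K_promotion[OF rN M, of "(K_promotion N r k ^^ l) T"]
    by (simp add: image_comp)
qed

section \<open>Powers of the rotation and invariant segments\<close>

text \<open>Within \<open>M - 1\<close> steps a point wraps around at most once, at step
  \<open>x - 1\<close>.\<close>

lemma funpow_rot:
  assumes "x \<in> {2..M}" "l \<le> M - 1"
  shows "(rot M ^^ l) x = (if l + 2 \<le> x then x - l else x + (M - 1) - l)"
  using assms(2)
proof (induction l)
  case 0
  then show ?case using assms(1) by auto
next
  case (Suc l)
  then show ?case using assms(1) by (auto simp: rot_def)
qed

lemma inj_on_funpow_rot: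
  assumes "l \<le> M - 1"
  shows "inj_on (rot M ^^ l) {2..M}"
proof (rule inj_onI)
  fix x y assume "x \<in> {2..M}" "y \<in> {2..M}" "(rot M ^^ l) x = (rot M ^^ l) y"
  then show "x = y" using assms by (auto simp: funpow_rot split: if_splits)
qed

lemma funpow_rot_mem_iff:
  assumes "l \<le> M - 1" "S \<subseteq> {2..M}" "(rot M ^^ l) ` S = S" "x \<in> {2..M}"
  shows "(rot M ^^ l) x \<in> S \<longleftrightarrow> x \<in> S"
  using inj_on_image_mem_iff[OF inj_on_funpow_rot[OF assms(1)] assms(4,2)] assms(3) by simp

text \<open>The point \<open>l + 2\<close>, which lands on \<open>2\<close>, must lie in the
  segment. Then \<open>t + 1\<close>, just outside, moves down into it without wrapping.\<close>

lemma initial_segment_not_rot_invariant: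
  assumes "2 \<le> t" "t < M" "0 < l" "l < M - 1"
  shows "(rot M ^^ l) ` {2..t} \<noteq> {2..t}"
proof
  assume inv: "(rot M ^^ l) ` {2..t} = {2..t}"
  have iff: "(rot M ^^ l) x \<in> {2..t} \<longleftrightarrow> x \<in> {2..t}" if "x \<in> {2..M}" for x
    by (rule funpow_rot_mem_iff[OF _ _ inv that]) (use assms in auto)
  have "l + 2 \<in> {2..t}" using iff[of "l + 2"] assms by (simp add: funpow_rot)
  then show False using iff[of "t + 1"] assms by (auto simp: funpow_rot)
qed

text \<open>The point \<open>l + 1\<close>, which lands on \<open>M\<close>, must lie in the
  segment. Then \<open>u - 1\<close>, just outside, wraps around into it.\<close>

lemma final_segment_not_rot_invariant:
  assumes "2 < u" "u \<le> M" "0 < l" "l < M - 1"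
  shows "(rot M ^^ l) ` {u..M} \<noteq> {u..M}"
proof
  assume inv: "(rot M ^^ l) ` {u..M} = {u..M}"
  have iff: "(rot M ^^ l) x \<in> {u..M} \<longleftrightarrow> x \<in> {u..M}" if "x \<in> {2..M}" for x
    by (rule funpow_rot_mem_iff[OF _ _ inv that]) (use assms in auto)
  have "l + 1 \<in> {u..M}" using iff[of "l + 1"] assms by (simp add: funpow_rot)
  moreover obtain v where "u = Suc v" using assms(1) by (cases u) auto
  ultimately show False using iff[of v] assms by (auto simp: funpow_rot)
qed

section \<open>The extremal tableau and the order of promotion\<close>

text \<open>\<open>k \<le> r\<close> keeps the arm within \<open>{2..N - k}\<close>, and
  \<open>k + r < N\<close> keeps the leg above \<open>1\<close>; the two segments overlap in
  \<open>k\<close> values.\<close>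

lemma segment_hook_tableau:
  assumes "k \<le> r" "k + r < N"
  obtains T where "hook_tableau (N - r) (r + 1) (N - k) T"
    "arm (N - r) T = {2..N - r}" "leg (r + 1) T = {N - k - r + 1..N - k}"
proof
  define T :: "box \<Rightarrow> nat" where
    "T = (\<lambda>(i, j). if i = 1 \<and> 1 \<le> j \<and> j \<le> N - r then j
       else if j = 1 \<and> 2 \<le> i \<and> i \<le> r + 1 then (N - k - r - 1) + i else 0)"
  show arm: "arm (N - r) T = {2..N - r}" by (auto simp: arm_def T_def image_iff)
  have "leg (r + 1) T = (\<lambda>i. (N - k - r - 1) + i) ` {2..r + 1}"
    unfolding leg_def by (rule image_cong) (auto simp: T_def)
  also have "\<dots> = {N - k - r + 1..N - k}"
    unfolding image_add_atLeastAtMost using assms by auto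
  finally show leg: "leg (r + 1) T = {N - k - r + 1..N - k}" .
  have "arm (N - r) T \<union> leg (r + 1) T = {2..N - k}"
    unfolding arm leg using assms by auto
  moreover have "T (1, 1) = 1" using assms by (simp add: T_def)
  moreover have "strict_mono_on {2..N - r} (\<lambda>j. T (1, j))" "strict_mono_on {2..r + 1} (\<lambda>i. T (i, 1))"
    by (auto simp: strict_mono_on_def T_def)
  moreover have "\<forall>x. x \<notin> hook_boxes (N - r) (r + 1) \<longrightarrow> T x = 0"
    by (auto simp: T_def hook_boxes_def)
  ultimately show "hook_tableau (N - r) (r + 1) (N - k) T"
    unfolding hook_tableau_def by blast
qed

text \<open>The assumption \<open>nonempty\<close> provides a tableau. The cases ruled out by
  \<open>nondegenerate\<close> are those with a single tableau although \<open>N - k - 1\<close> is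
  not \<open>1\<close>.\<close>

theorem theorem3p3:
  fixes N k r :: nat
  assumes nonempty: "k \<le> r" "k + r < N"
    and nondegenerate: "(0 < r \<and> r + 1 < N \<and> N \<noteq> 2 * k + 1) \<or> N = k + 2"
  shows "0 < N - k - 1
    \<and> (\<forall>T\<in>Inc k (hook N r). (K_promotion N r k ^^ (N - k - 1)) T = T)
    \<and> (\<forall>l. 0 < l \<and> (\<forall>T\<in>Inc k (hook N r). (K_promotion N r k ^^ l) T = T) \<longrightarrow> N - k - 1 \<le> l)"
proof (intro conjI ballI allI impI)
  have rN: "r < N" and kN: "k < N" and M: "2 \<le> N - k" using assms by auto
  then show "0 < N - k - 1" by simp
  fix T assume "T \<in> Inc k (hook N r)"
  then have T: "hook_tableau (N - r) (r + 1) (N - k) T"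
    by (rule Inc_hook_imp_hook_tableau[OF rN])
  have id: "(rot (N - k) ^^ (N - k - 1)) ` S = S" if "S \<subseteq> {2..N - k}" for S
  proof -
    have "(rot (N - k) ^^ (N - k - 1)) x = x" if "x \<in> S" for x
      using \<open>S \<subseteq> _\<close> that by (subst funpow_rot) auto
    then show ?thesis by force
  qed
  have "arm (N - r) T \<subseteq> {2..N - k}" "leg (r + 1) T \<subseteq> {2..N - k}"
    using T unfolding hook_tableau_def by blast+
  then show "(K_promotion N r k ^^ (N - k - 1)) T = T"
    using hook_tableau_funpow_K_promotion[OF rN M T, of "N - k - 1"] hook_tableau_eqI[OF _ T] id
    by metis
next
  fix l assume l: "0 < l \<and> (\<forall>T\<in>Inc k (hook N r). (K_promotion N r k ^^ l) T = T)"
  have rN: "r < N" and kN: "k < N" and M: "2 \<le> N - k" using assms by auto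
  obtain T where T: "hook_tableau (N - r) (r + 1) (N - k) T"
    and arm: "arm (N - r) T = {2..N - r}" and leg: "leg (r + 1) T = {N - k - r + 1..N - k}"
    using segment_hook_tableau[OF nonempty] .
  have "(K_promotion N r k ^^ l) T = T"
    using l hook_tableau_imp_Inc_hook[OF rN kN T] by blast
  then have inv: "(rot (N - k) ^^ l) ` {2..N - r} = {2..N - r}"
      "(rot (N - k) ^^ l) ` {N - k - r + 1..N - k} = {N - k - r + 1..N - k}"
    using hook_tableau_funpow_K_promotion[OF rN M T, of l] arm leg by simp_all
  show "N - k - 1 \<le> l"
  proof (rule ccontr)
    assume "\<not> N - k - 1 \<le> l"
    then have lt: "l < N - k - 1" by simp
    \<comment> \<open>\<open>N = k + 2\<close> would leave no positive \<open>l\<close> below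
      \<open>N - k - 1\<close>.\<close>
    then have nd: "0 < r" "r + 1 < N" "N \<noteq> 2 * k + 1" using nondegenerate l by auto
    have "2 \<le> N - r" using nd(2) by linarith
    show False
    proof (cases "k < r")
      case True
      \<comment> \<open>The arm is a proper initial segment.\<close>
      then have "N - r < N - k" using rN by linarith
      then show False
        using initial_segment_not_rot_invariant[OF \<open>2 \<le> N - r\<close>] inv(1) l lt by blast
    next
      case False
      \<comment> \<open>Here \<open>k = r\<close> and the arm is all of \<open>{2..N - k}\<close>,
        but \<open>N \<noteq> 2 * k + 1\<close> makes the leg a proper final segment, nonempty by
        \<open>0 < r\<close>.\<close>
      then have "2 < N - k - r + 1" "N - k - r + 1 \<le> N - k" using nd nonempty by linarith+
      then show False
        using final_segment_not_rot_invariant inv(2) l lt by blast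
    qed
  qed
qed

end
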